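(* Let $n \geq 1$ and $k \geq 2$ be integers. If $n \not\equiv 1 \pmod{k-1}$, then \[\mathcal{G}(K_n, \mathcal{T}_k) = \left\lfloor\frac{n}{k-1}\right\rfloor \binom{k-1}{2} + \binom{n-(k-1)\lfloor\frac{n}{k-1}\rfloor}{2}.\] If $n \equiv 1 \pmod{k-1}$ and $k \geq 3$, then \[\frac{n}{k-1}\binom{k-1}{2} - (k-3) \leq \mathcal{G}(K_n, \mathcal{T}_k) \leq \frac{n}{k-1}\binom{k-1}{2}.\]
   Context: $\mathcal{T}_k$ is the family of all trees on $k$ vertices. For a family $\mathcal{F}$ of graphs, a graph is $\mathcal{F}$-free if it contains no member of $\mathcal{F}$ as a subgraph; a subgraph $G \subseteq H$ is $\mathcal{F}$-saturated in $H$ if it is a maximal $\mathcal{F}$-free subgraph of $H$. The $\mathcal{F}$-saturation game $\mathcal{G}(H;\mathcal{F})$: two players, Prolonger and Shortener, alternately add to a graph on $V(H)$, starting from the empty graph, one edge of $H$ not yet present such that the graph remains $\mathcal{F}$-free; the game ends when the graph is $\mathcal{F}$-saturated in $H$. Prolonger aims to maximise and Shortener to minimise the number of edges added; $\mathcal{G}(H;\mathcal{F})$ also denotes this number under optimal play by both players (the game saturation number). The results hold regardless of which player moves first. $\mathcal{G}(K_n, \mathcal{T}_k)$ means $H = K_n$, $\mathcal{F} = \mathcal{T}_k$.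
   Formalization: In the case n ≡ 1 (mod k-1), the quotient n/(k-1) in both bounds is read as its floor, as in the first formula; the unrounded lower bound is false (k = 3, n = 3 would give 3/2 ≤ 1). *)

theory Defs
  imports Complex_Main "HOL-Number_Theory.Cong"
begin

record 'a ugraph =
  verts :: "'a set"
  edges :: "'a set set"

definition simple_graph :: "'a ugraph \<Rightarrow> bool" where
  "simple_graph G \<longleftrightarrow> (\<forall>e\<in>edges G. e \<subseteq> verts G \<and> card e = 2)"

definition subgraph :: "'a ugraph \<Rightarrow> 'a ugraph \<Rightarrow> bool" where
  "subgraph G H \<longleftrightarrow> simple_graph G \<and> verts G \<subseteq> verts H \<and> edges G \<subseteq> edges H"

definition connected_graph :: "'a ugraph \<Rightarrow> bool" where
  "connected_graph G \<longleftrightarrow> verts G \<noteq> {} \<and>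
     (\<forall>u\<in>verts G. \<forall>v\<in>verts G. (u, v) \<in> {(x, y). {x, y} \<in> edges G}\<^sup>*)"

definition is_cycle :: "'a ugraph \<Rightarrow> 'a list \<Rightarrow> bool" where
  "is_cycle G xs \<longleftrightarrow> length xs \<ge> 3 \<and> distinct xs \<and> set xs \<subseteq> verts G \<and>
     (\<forall>i<length xs. {xs ! i, xs ! ((i + 1) mod length xs)} \<in> edges G)"

definition is_tree :: "'a ugraph \<Rightarrow> bool" where
  "is_tree G \<longleftrightarrow> simple_graph G \<and> finite (verts G) \<and> connected_graph G \<and> (\<nexists>xs. is_cycle G xs)"

(* Forbidden graphs only matter up to isomorphism, so vertices are taken in nat. *)
definition trees :: "nat \<Rightarrow> nat ugraph set" where
  "trees k = {T. is_tree T \<and> card (verts T) = k}"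

(* G contains a (not necessarily induced) copy of the pattern P. *)
definition contains_copy :: "'a ugraph \<Rightarrow> 'b ugraph \<Rightarrow> bool" where
  "contains_copy G P \<longleftrightarrow> (\<exists>f. inj_on f (verts P) \<and> f ` verts P \<subseteq> verts G \<and>
     (\<forall>e\<in>edges P. f ` e \<in> edges G))"

definition family_free :: "'b ugraph set \<Rightarrow> 'a ugraph \<Rightarrow> bool" where
  "family_free \<F> G \<longleftrightarrow> (\<forall>P\<in>\<F>. \<not> contains_copy G P)"

definition saturated_in :: "'a ugraph \<Rightarrow> 'b ugraph set \<Rightarrow> 'a ugraph \<Rightarrow> bool" where
  "saturated_in H \<F> G \<longleftrightarrow> subgraph G H \<and> family_free \<F> G \<and>
     (\<forall>G'. subgraph G' H \<and> family_free \<F> G' \<and> subgraph G G' \<longrightarrow> G' = G)"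

(* A position of the game on H is the set E of edges chosen so far. *)
abbreviation position_graph :: "'a ugraph \<Rightarrow> 'a set set \<Rightarrow> 'a ugraph" where
  "position_graph H E \<equiv> \<lparr>verts = verts H, edges = E\<rparr>"

definition legal_moves :: "'a ugraph \<Rightarrow> 'b ugraph set \<Rightarrow> 'a set set \<Rightarrow> 'a set set" where
  "legal_moves H \<F> E = {e \<in> edges H - E. family_free \<F> (position_graph H (insert e E))}"

datatype player = Prolonger | Shortener

fun opponent :: "player \<Rightarrow> player" where
  "opponent Prolonger = Shortener"
| "opponent Shortener = Prolonger"

(* Total number of edges at the end of the game under optimal play, when the given
   player is to move at E. Finiteness of the board only serves termination. *)
function position_value ::
    "'a ugraph \<Rightarrow> 'b ugraph set \<Rightarrow> player \<Rightarrow> 'a set set \<Rightarrow> nat" where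
  "position_value H \<F> p E =
     (if infinite (edges H) \<or> saturated_in H \<F> (position_graph H E) then card E
      else (case p of Prolonger \<Rightarrow> Max | Shortener \<Rightarrow> Min)
             ((\<lambda>e. position_value H \<F> (opponent p) (insert e E)) ` legal_moves H \<F> E))"
  by auto
termination
proof (relation "measure (\<lambda>(H, \<F>, p, E). card (edges H - E))", goal_cases)
  case 1
  show ?case by simp
next
  case (2 H \<F> p E e)
  then have "finite (edges H)" "e \<in> edges H - E"
    by (auto simp: legal_moves_def)
  then have "card (edges H - insert e E) < card (edges H - E)"
    by (intro psubset_card_mono) auto
  then show ?case by simp
qed

declare position_value.simps [simp del]

definition game_saturation_number :: "player \<Rightarrow> 'a ugraph \<Rightarrow> 'b ugraph set \<Rightarrow> nat" where
  "game_saturation_number first H \<F> = position_value H \<F> first {}"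

definition complete_graph :: "nat \<Rightarrow> nat ugraph" where
  "complete_graph n = \<lparr>verts = {..<n}, edges = {e. e \<subseteq> {..<n} \<and> card e = 2}\<rparr>"

lemma family_free_subgraph:
  fixes \<F> :: "'b ugraph set"
  assumes "family_free \<F> G" "verts G' \<subseteq> verts G" "edges G' \<subseteq> edges G"
  shows "family_free \<F> G'"
proof -
  have "contains_copy G P" if "contains_copy G' P" for P :: "'b ugraph"
    using that assms(2,3) unfolding contains_copy_def by (meson order_trans subsetD)
  then show ?thesis
    using assms(1) unfolding family_free_def by blast
qed

(* From a legal position the game stops exactly when no move is left; in particular
   Max and Min above are then never applied to the empty set. *)
lemma saturated_in_iff_no_legal_moves:
  assumes H: "simple_graph H" and E: "E \<subseteq> edges H"
    and free: "family_free \<F> (position_graph H E)"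
  shows "saturated_in H \<F> (position_graph H E) \<longleftrightarrow> legal_moves H \<F> E = {}"
proof
  assume sat: "saturated_in H \<F> (position_graph H E)"
  show "legal_moves H \<F> E = {}"
  proof (rule ccontr)
    assume "legal_moves H \<F> E \<noteq> {}"
    then obtain e where e: "e \<in> edges H" "e \<notin> E"
      "family_free \<F> (position_graph H (insert e E))"
      by (auto simp: legal_moves_def)
    have "subgraph (position_graph H (insert e E)) H"
      "subgraph (position_graph H E) (position_graph H (insert e E))"
      using H E e(1) by (auto simp: subgraph_def simple_graph_def)
    then have "position_graph H (insert e E) = position_graph H E"
      using sat e(3) unfolding saturated_in_def by blast
    then show False using e(2) by auto
  qed
next
  assume none: "legal_moves H \<F> E = {}"
  have "G' = position_graph H E"
    if G': "subgraph G' H" "family_free \<F> G'" "subgraph (position_graph H E) G'" for G'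
  proof -
    from G' have v: "verts G' = verts H" and "E \<subseteq> edges G'" and sub: "edges G' \<subseteq> edges H"
      by (simp_all add: subgraph_def subset_antisym)
    moreover have "e \<in> E" if "e \<in> edges G'" for e
    proof (rule ccontr)
      assume "e \<notin> E"
      have "family_free \<F> (position_graph H (insert e E))"
        using G'(2) by (rule family_free_subgraph) (use v that \<open>E \<subseteq> edges G'\<close> in auto)
      then show False using none \<open>e \<notin> E\<close> sub that by (auto simp: legal_moves_def)
    qed
    ultimately have "edges G' = E" by blast
    with v show ?thesis by (cases G') simp
  qed
  moreover have "subgraph (position_graph H E) H"
    using H E by (auto simp: subgraph_def simple_graph_def)
  ultimately show "saturated_in H \<F> (position_graph H E)"
    using free unfolding saturated_in_def by blast
qed

end

(* A graph avoids all trees on m + 1 vertices iff all its components have at most m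
   vertices, so the game is one of merging components: at the end all components are
   cliques and any two of them have more than m vertices together. The number of edges
   is then the sum of (c choose 2) over the component sizes c, which by convexity is
   largest for the sizes m, ..., m, n mod m; this bounds the value from above.

   Prolonger makes sure that after each of his moves at most one component has size
   strictly between 1 and m. If Shortener answers with a second such component, it is a
   new edge, and Prolonger merges it into the first one; if the first one has size m - 1,
   he instead completes it with an isolated vertex. This fails only if no isolated vertex
   is left, and then the sizes are m, ..., m, m - 1, 2, so that n mod m = 1 and the final
   graph has m - 2 edges fewer than the extremal one. *)

theory Submission
  imports Defs "HOL-Library.Disjoint_Sets"
begin

section \<open>Connected components and how one new edge changes them\<close>

section \<open>Components\<close>

definition adj :: "'a set set \<Rightarrow> ('a \<times> 'a) set" where
  "adj E = {(x, y). {x, y} \<in> E}"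

text \<open>A vertex on no edge gets a singleton component, so isolated vertices appear as blocks of
  size 1.\<close>

definition component :: "'a set set \<Rightarrow> 'a \<Rightarrow> 'a set" where
  "component E v = (adj E)\<^sup>* `` {v}"

definition components :: "'a set \<Rightarrow> 'a set set \<Rightarrow> 'a set set" where
  "components V E = component E ` V"

lemma component_refl [simp]: "v \<in> component E v"
  by (simp add: component_def)

lemma sym_adj: "sym (adj E)"
  by (auto simp: sym_def adj_def insert_commute)

lemma component_sym: "w \<in> component E v \<Longrightarrow> v \<in> component E w"
  using sym_rtrancl[OF sym_adj[of E]] by (auto simp: component_def sym_def)

lemma component_trans: "w \<in> component E v \<Longrightarrow> x \<in> component E w \<Longrightarrow> x \<in> component E v"
  by (auto simp: component_def)

lemma component_eq:
  assumes "w \<in> component E v"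
  shows "component E w = component E v"
  using component_trans[OF assms] component_trans[OF component_sym[OF assms]] by (intro set_eqI iffI)

lemma component_eq_iff: "component E w = component E v \<longleftrightarrow> w \<in> component E v"
proof
  assume "component E w = component E v"
  then show "w \<in> component E v" using component_refl[of w E] by simp
qed (rule component_eq)

lemma component_disjoint:
  assumes "component E v \<noteq> component E w"
  shows "component E v \<inter> component E w = {}"
proof (rule ccontr)
  assume "component E v \<inter> component E w \<noteq> {}"
  then obtain x where "x \<in> component E v" "x \<in> component E w" by blast
  then show False using assms component_eq[of x E v] component_eq[of x E w] by simp
qed

lemma component_edge: "{u, v} \<in> E \<Longrightarrow> v \<in> component E u"
  by (auto simp: component_def adj_def)

text \<open>A path through the new edge meets \<open>u\<close> and \<open>v\<close>, so only their
  components are affected, and these two are joined.\<close>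

lemma component_insert:
  "component (insert {u, v} E) w =
     (if w \<in> component E u \<union> component E v then component E u \<union> component E v else component E w)"
proof -
  have adj: "adj (insert {u, v} E) = insert (u, v) (insert (v, u) (adj E))"
    by (auto simp: adj_def doubleton_eq_iff)
  have iff: "(x, y) \<in> (adj E)\<^sup>* \<longleftrightarrow> y \<in> component E x" for x y
    by (simp add: component_def)
  have mem: "x \<in> component (insert {u, v} E) w \<longleftrightarrow>
      x \<in> component E w \<or> w \<in> component E u \<union> component E v \<and> x \<in> component E u \<union> component E v" for x
  proof -
    have "x \<in> component (insert {u, v} E) w \<longleftrightarrow> (w, x) \<in> (insert (u, v) (insert (v, u) (adj E)))\<^sup>*"
      by (simp add: component_def adj)
    also have "\<dots> \<longleftrightarrow> x \<in> component E w \<or> w \<in> component E u \<union> component E v \<and> x \<in> component E u \<union> component E v"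
      \<comment> \<open>Turning each membership into an equality of components leaves a question
        about equalities alone, where symmetry and transitivity come for free.\<close>
      unfolding rtrancl_insert by (simp add: iff flip: component_eq_iff) (smt (verit))
    finally show ?thesis .
  qed
  show ?thesis
  proof (cases "w \<in> component E u \<union> component E v")
    case True
    then have "component E w \<subseteq> component E u \<union> component E v"
      using component_eq[of w E u] component_eq[of w E v] by blast
    then have "component (insert {u, v} E) w = component E u \<union> component E v"
      using True by (intro set_eqI) (simp only: mem, blast)
    then show ?thesis
      using True by (simp only: if_True)
  next
    case False
    then have "component (insert {u, v} E) w = component E w"
      by (intro set_eqI) (simp only: mem, blast)
    then show ?thesis
      using False by (simp only: if_False)
  qed
qed

lemma component_insert_same:
  assumes "v \<in> component E u"
  shows "component (insert {u, v} E) = component E"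
proof
  show "component (insert {u, v} E) w = component E w" for w
    using component_eq[OF assms] component_eq[of w E u] by (auto simp: component_insert)
qed

text \<open>The new blocks are the image of the old ones under the map that sends both touched
  blocks to their union and fixes the rest.\<close>

lemma components_insert_merge:
  assumes "u \<in> V" "v \<in> V"
  shows "components V (insert {u, v} E) =
    insert (component E u \<union> component E v) (components V E - {component E u, component E v})"
proof -
  have "component (insert {u, v} E) w =
      (if component E w \<in> {component E u, component E v} then component E u \<union> component E v else component E w)" for w
    by (simp add: component_insert component_eq_iff)
  then have "components V (insert {u, v} E) =
      (\<lambda>X. if X \<in> {component E u, component E v} then component E u \<union> component E v else X) ` components V E"
    unfolding components_def image_image by (rule image_cong[OF refl])
  moreover have "component E u \<in> components V E"
    using assms by (simp add: components_def)
  ultimately show ?thesis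
    by auto
qed

lemma component_subset:
  assumes "v \<in> V" "\<And>e. e \<in> E \<Longrightarrow> e \<subseteq> V"
  shows "component E v \<subseteq> V"
proof
  fix w assume "w \<in> component E v"
  then have "(v, w) \<in> (adj E)\<^sup>*" by (simp add: component_def)
  then show "w \<in> V"
    by (induction) (use assms in \<open>auto simp: adj_def\<close>)
qed

lemma partition_on_components:
  assumes "\<And>e. e \<in> E \<Longrightarrow> e \<subseteq> V"
  shows "partition_on V (components V E)"
proof (rule partition_onI)
  show "\<Union> (components V E) = V"
  proof
    show "\<Union> (components V E) \<subseteq> V"
      unfolding components_def using component_subset[of _ V E] assms by (intro UN_least) simp
    show "V \<subseteq> \<Union> (components V E)"
      unfolding components_def using component_refl[of _ E] by (blast intro: UN_I)
  qed
  show "disjnt X Y" if "X \<in> components V E" "Y \<in> components V E" "X \<noteq> Y" for X Y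
    using that component_disjoint unfolding components_def disjnt_def by (elim imageE) simp
  show "{} \<notin> components V E"
  proof
    assume "{} \<in> components V E"
    then obtain v where "component E v = {}"
      by (auto simp: components_def)
    then show False
      by (metis component_refl empty_iff)
  qed
qed

section \<open>The extremal number of edges and the convexity behind it\<close>

section \<open>Counting edges of disjoint cliques\<close>

text \<open>With \<open>m = k - 1\<close>: as many disjoint cliques of order \<open>m\<close> as fit
  into \<open>n\<close> vertices, and one clique on the remaining vertices. This is the extremal
  number of edges for components of order at most \<open>m\<close>.\<close>

definition edges_bound :: "nat \<Rightarrow> nat \<Rightarrow> nat" where
  "edges_bound m n = (n div m) * (m choose 2) + ((n mod m) choose 2)"

text \<open>Convexity: by \<open>2 * (x choose 2) = x * x - x\<close>, the right side exceeds the
  left by \<open>(a - c) * (a - d)\<close>.\<close>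

lemma choose_two_spread:
  fixes a b c d :: nat
  assumes "a + b = c + d" "c \<le> a" "d \<le> a"
  shows "(c choose 2) + (d choose 2) \<le> (a choose 2) + (b choose 2)"
proof -
  have eq: "2 * int (x choose 2) = int x * int x - int x" for x :: nat
  proof -
    have "even (x * (x - 1))"
      by (cases x) auto
    then have "2 * (x choose 2) = x * (x - 1)"
      unfolding choose_two by (rule dvd_mult_div_cancel)
    then have "2 * int (x choose 2) = int (x * (x - 1))"
      by (metis of_nat_mult of_nat_numeral)
    then show ?thesis
      by (cases x) (simp_all add: algebra_simps)
  qed
  have d: "int d = int a + int b - int c" using assms by linarith
  have "0 \<le> (int a - int c) * (int a - int d)" using assms by simp
  then have "int c * int c - int c + (int d * int d - int d) \<le> int a * int a - int a + (int b * int b - int b)"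
    unfolding d by (simp add: algebra_simps)
  then show ?thesis using eq[of a] eq[of b] eq[of c] eq[of d] by linarith
qed

lemma edges_bound_decomp:
  assumes "r < m"
  shows "edges_bound m (q * m + r) = q * (m choose 2) + (r choose 2)"
  using assms by (simp add: edges_bound_def)

text \<open>A clique of order \<open>c\<close> is placed beside the extremal arrangement on
  \<open>x\<close> vertices. If it fits together with the remainder \<open>s\<close> below
  \<open>m\<close>, the two are joined; otherwise they are redistributed as a full block and the
  rest. Either way the sizes move apart, and \<open>choose_two_spread\<close> applies.\<close>

lemma edges_bound_add:
  assumes "c \<le> m" "m > 0"
  shows "edges_bound m x + (c choose 2) \<le> edges_bound m (c + x)"
proof -
  define q s where "q = x div m" and "s = x mod m"
  have s: "s < m" and x: "x = q * m + s" using assms by (simp_all add: q_def s_def)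
  show ?thesis
  proof (cases "s + c < m")
    case True
    have "c + x = q * m + (s + c)" using x by simp
    then have "edges_bound m (c + x) = q * (m choose 2) + (s + c choose 2)"
      by (simp only: edges_bound_decomp[OF True])
    then show ?thesis
      using choose_two_spread[of "s + c" 0 s c] edges_bound_decomp[OF s] x
      by (simp add: binomial_eq_0)
  next
    case False
    then have "c + x = Suc q * m + (s + c - m)" and *: "s + c - m < m"
      using x s assms by auto
    then have "edges_bound m (c + x) = Suc q * (m choose 2) + (s + c - m choose 2)"
      by (simp only: edges_bound_decomp[OF *])
    then show ?thesis
      using choose_two_spread[of m "s + c - m" s c] edges_bound_decomp[OF s] False s x assms
      by simp
  qed
qed

definition clique_edges :: "'a set set \<Rightarrow> nat" where
  "clique_edges P = (\<Sum>X\<in>P. card X choose 2)"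

lemma clique_edges_le_edges_bound:
  assumes "finite P" "\<And>X. X \<in> P \<Longrightarrow> card X \<le> m" "m > 0"
  shows "clique_edges P \<le> edges_bound m (\<Sum>X\<in>P. card X)"
  using assms(1,2) unfolding clique_edges_def
proof (induction P)
  case empty
  then show ?case by simp
next
  case (insert X P)
  then have "(\<Sum>X\<in>P. card X choose 2) \<le> edges_bound m (sum card P)" "card X \<le> m"
    by auto
  then show ?case
    using edges_bound_add[of "card X" m "sum card P"] assms(3) insert.hyps by simp
qed

section \<open>The game reduced to partitions of the vertex set\<close>

section \<open>Partitions into blocks of bounded size\<close>

text \<open>Only these blocks need Prolonger's care: a singleton fits beside every block that is not
  full, and a full block takes part in no further merge.\<close>

definition small :: "nat \<Rightarrow> 'a set \<Rightarrow> bool" where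
  "small m X \<longleftrightarrow> 1 < card X \<and> card X < m"

text \<open>The partition is then final, even if edges inside blocks are still missing.\<close>

definition settled :: "nat \<Rightarrow> 'a set set \<Rightarrow> bool" where
  "settled m P \<longleftrightarrow> (\<forall>X\<in>P. \<forall>Y\<in>P. X \<noteq> Y \<longrightarrow> m < card X + card Y)"

definition good :: "nat \<Rightarrow> 'a set set \<Rightarrow> bool" where
  "good m P \<longleftrightarrow> (\<forall>X\<in>P. \<forall>Y\<in>P. small m X \<longrightarrow> small m Y \<longrightarrow> X = Y)"

text \<open>The block \<open>D\<close> is the edge that Shortener has just drawn between two isolated vertices.\<close>

definition nearly_good :: "nat \<Rightarrow> 'a set set \<Rightarrow> bool" where
  "nearly_good m P \<longleftrightarrow> good m P \<or> (\<exists>D\<in>P. card D = 2 \<and> good m (P - {D}))"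

definition merge :: "'a set \<Rightarrow> 'a set \<Rightarrow> 'a set set \<Rightarrow> 'a set set" where
  "merge X Y P = insert (X \<union> Y) (P - {X, Y})"

text \<open>The strategy is argued for partitions alone; the blocks will be the components of a
  position, by \<open>components_position\<close>.\<close>

locale bounded_partition =
  fixes m :: nat and V :: "'a set" and P :: "'a set set"
  assumes m: "2 \<le> m" and finite_V: "finite V" and partition: "partition_on V P"
    and bounded: "X \<in> P \<Longrightarrow> card X \<le> m"
begin

lemma finite_P: "finite P"
  using finite_elements[OF finite_V partition] .

lemma finite_block: "X \<in> P \<Longrightarrow> finite X"
  using finite_V partition_onD1[OF partition] by (metis Sup_upper finite_subset)

lemma card_block_pos: "X \<in> P \<Longrightarrow> 0 < card X"
  using finite_block partition_onD3[OF partition] by (metis card_gt_0_iff)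

lemma card_V: "card V = (\<Sum>X\<in>P. card X)"
  using product_partition[OF partition finite_block] .

lemma card_Un_blocks: "X \<in> P \<Longrightarrow> Y \<in> P \<Longrightarrow> X \<noteq> Y \<Longrightarrow> card (X \<union> Y) = card X + card Y"
  using finite_block disjointD[OF partition_onD2[OF partition]] by (simp add: card_Un_disjoint)

lemma card_one_iff: "X \<in> P \<Longrightarrow> card X < m \<Longrightarrow> \<not> small m X \<longleftrightarrow> card X = 1"
  using card_block_pos[of X] by (auto simp: small_def)

lemma clique_edges_le: "clique_edges P \<le> edges_bound m (card V)"
  unfolding card_V using m by (intro clique_edges_le_edges_bound finite_P bounded) auto

text \<open>With \<open>q\<close> full blocks split off, the count of a settled partition depends
  only on the few blocks that are not full.\<close>

lemma full_blocks:
  obtains q where "clique_edges P = q * (m choose 2) + clique_edges {X \<in> P. card X < m}"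
    and "card V = q * m + (\<Sum>X | X \<in> P \<and> card X < m. card X)"
proof
  let ?F = "{X \<in> P. card X = m}" and ?N = "{X \<in> P. card X < m}"
  have P: "P = ?F \<union> ?N" "?F \<inter> ?N = {}" and fin: "finite ?F" "finite ?N"
    using bounded finite_P by (auto simp: le_less)
  have split: "sum f P = sum f ?F + sum f ?N" for f :: "'a set \<Rightarrow> nat"
    using sum.union_disjoint[OF fin P(2), of f] P(1) by simp
  show "clique_edges P = card ?F * (m choose 2) + clique_edges ?N"
    unfolding clique_edges_def split by simp
  show "card V = card ?F * m + sum card ?N"
    unfolding card_V split by simp
qed

section \<open>Moves of the two players as merges of blocks\<close>

lemma good_merge:
  assumes "\<And>Z. Z \<in> P \<Longrightarrow> small m Z \<Longrightarrow> Z = X \<or> Z = Y"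
  shows "good m (merge X Y P)"
  using assms by (auto simp: good_def merge_def)

text \<open>Prolonger's reply. Since the partition is not settled, some \<open>A\<close> and
  \<open>B\<close> fit together; when a singleton is needed to extend a small block, it is found
  among these two.\<close>

lemma nearly_good_move:
  assumes "nearly_good m P" "\<not> settled m P"
  obtains X Y where "X \<in> P" "Y \<in> P" "X \<noteq> Y" "card X + card Y \<le> m" "good m (merge X Y P)"
proof -
  obtain A B where AB: "A \<in> P" "B \<in> P" "A \<noteq> B" "card A + card B \<le> m"
    using assms(2) by (auto simp: settled_def not_less)
  have lt: "card A < m" "card B < m"
    using AB card_block_pos[of A] card_block_pos[of B] by simp_all
  show ?thesis
  proof (cases "good m P")
    case True
    show ?thesis
    proof (cases "\<exists>S\<in>P. small m S \<and> S \<noteq> A \<and> S \<noteq> B")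
      case False
      have "good m (merge A B P)"
        by (rule good_merge) (use False in blast)
      then show ?thesis
        using that AB by blast
    next
      case T: True
      then obtain S where S: "S \<in> P" "small m S" "S \<noteq> A" "S \<noteq> B" by blast
      have only: "Z = S" if "Z \<in> P" "small m Z" for Z
        using True that S by (simp add: good_def)
      \<comment> \<open>\<open>S\<close> is the only small block, so \<open>A\<close> is a
        singleton, and a small block has room for one more vertex.\<close>
      then have "card A = 1"
        using S card_one_iff[OF AB(1) lt(1)] AB by blast
      then have "card S + card A \<le> m"
        using S by (simp add: small_def)
      moreover have "good m (merge S A P)"
        by (rule good_merge) (use only in blast)
      ultimately show ?thesis
        using that S AB by blast
    qed
  next
    case False
    then obtain D where D: "D \<in> P" "card D = 2" "good m (P - {D})"
      using assms(1) by (auto simp: nearly_good_def)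
    have "\<exists>S\<in>P. small m S \<and> S \<noteq> D"
      using False by (auto simp: good_def)
    then obtain S where S: "S \<in> P" "small m S" "S \<noteq> D" by blast
    have only: "Z = D \<or> Z = S" if "Z \<in> P" "small m Z" for Z
      using D(3) that S by (auto simp: good_def)
    show ?thesis
    proof (cases "card D + card S \<le> m")
      case True
      have "good m (merge D S P)"
        by (rule good_merge) (use only in blast)
      then show ?thesis
        using that True D S by blast
    next
      case big: False
      \<comment> \<open>\<open>A\<close> and \<open>B\<close> fit together while \<open>D\<close>
        and \<open>S\<close> do not, so one of them lies outside \<open>{D, S}\<close> and must be a
        singleton.\<close>
      have "\<exists>C\<in>{A, B}. C \<noteq> D \<and> C \<noteq> S"
        using big AB by (metis add.commute insertI1 insertI2)
      then obtain C where C: "C \<in> P" "card C < m" "C \<noteq> D" "C \<noteq> S"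
        using AB lt by blast
      then have "card C = 1"
        using only card_one_iff by blast
      \<comment> \<open>As \<open>D\<close> has two vertices and does not fit beside
        \<open>S\<close>, the block \<open>S\<close> lacks exactly one vertex; \<open>C\<close>
        completes it, and only \<open>D\<close> stays small.\<close>
      then have sum: "card S + card C = m"
        using big S D by (simp add: small_def)
      then have "\<not> small m (S \<union> C)"
        using card_Un_blocks[of S C] S C by (simp add: small_def)
      then have "good m (merge S C P)"
        using only by (auto simp: good_def merge_def)
      then show ?thesis
        using that[of S C] S C sum by blast
    qed
  qed
qed

text \<open>Covers every merge by Shortener: if a small block takes part, the union absorbs the only
  one; otherwise both blocks are singletons and their union is the exceptional block of two
  vertices.\<close>

lemma nearly_good_merge:
  assumes "good m P" "X \<in> P" "Y \<in> P" "X \<noteq> Y" "card X + card Y \<le> m"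
  shows "nearly_good m (merge X Y P)"
proof (cases "small m X \<or> small m Y")
  case True
  then have "\<And>Z. Z \<in> P \<Longrightarrow> small m Z \<Longrightarrow> Z = X \<or> Z = Y"
    using assms by (auto simp: good_def)
  then show ?thesis
    using good_merge by (simp add: nearly_good_def)
next
  case False
  have "card X < m" "card Y < m"
    using assms card_block_pos[of X] card_block_pos[of Y] by simp_all
  then have "card (X \<union> Y) = 2"
    using False assms card_one_iff card_Un_blocks[of X Y] by simp
  moreover have "good m (merge X Y P - {X \<union> Y})"
    using assms(1) by (auto simp: good_def merge_def)
  ultimately show ?thesis
    by (auto simp: nearly_good_def merge_def)
qed

section \<open>Edge counts of settled partitions\<close>

text \<open>At most one block is not full, so the sizes are those of the extremal
  arrangement.\<close>

lemma clique_edges_good_settled: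
  assumes "good m P" "settled m P"
  shows "clique_edges P = edges_bound m (card V)"
proof -
  let ?N = "{X \<in> P. card X < m}"
  obtain q where q: "clique_edges P = q * (m choose 2) + clique_edges ?N"
    "card V = q * m + sum card ?N"
    by (rule full_blocks)
  have unique: "X = Y" if "X \<in> ?N" "Y \<in> ?N" for X Y
  proof (rule ccontr)
    assume "X \<noteq> Y"
    then have "m < card X + card Y"
      using assms(2) that by (simp add: settled_def)
    \<comment> \<open>A sum above \<open>m\<close> with both sizes below \<open>m\<close> forces
      both sizes above 1.\<close>
    then have "small m X" "small m Y"
      using that by (auto simp: small_def)
    then show False
      using assms(1) that \<open>X \<noteq> Y\<close> by (simp add: good_def)
  qed
  show ?thesis
  proof (cases "?N = {}")
    case True
    then have "clique_edges P = q * (m choose 2)" "card V = q * m + 0"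
      using q unfolding True by (simp_all add: clique_edges_def)
    then show ?thesis
      using m edges_bound_decomp[of 0 m q] by (simp add: binomial_eq_0)
  next
    case False
    then obtain A where "A \<in> ?N" by blast
    then have A: "?N = {A}" "card A < m" using unique by auto
    then have "clique_edges P = q * (m choose 2) + (card A choose 2)" "card V = q * m + card A"
      using q unfolding A(1) by (simp_all add: clique_edges_def)
    then show ?thesis
      using edges_bound_decomp[OF A(2)] by simp
  qed
qed

text \<open>The sizes \<open>m - 1\<close> and 2 stand where the extremal arrangement has
  \<open>m\<close> and 1, which costs \<open>(m choose 2) - (m - 1 choose 2) - 1 = m - 2\<close>
  edges.\<close>

lemma clique_edges_nearly_good_settled:
  assumes "nearly_good m P" "\<not> good m P" "settled m P"
  shows "card V mod m = 1" and "clique_edges P + (m - 2) = edges_bound m (card V)"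
proof -
  let ?N = "{X \<in> P. card X < m}"
  obtain q where q: "clique_edges P = q * (m choose 2) + clique_edges ?N"
    "card V = q * m + sum card ?N"
    by (rule full_blocks)
  obtain D where D: "D \<in> P" "card D = 2" "good m (P - {D})"
    using assms by (auto simp: nearly_good_def)
  obtain A B where AB: "A \<in> P" "B \<in> P" "small m A" "small m B" "A \<noteq> B"
    using assms(2) by (auto simp: good_def)
  have "\<exists>S\<in>P. small m S \<and> S \<noteq> D"
    using AB by metis
  then obtain S where S: "S \<in> P" "small m S" "S \<noteq> D" by blast
  \<comment> \<open>Removing \<open>D\<close> makes the partition good, so \<open>D\<close> is one
    of any two small blocks; this rules out \<open>m = 2\<close>.\<close>
  have "A = D \<or> B = D"
    using D(3) AB by (auto simp: good_def)
  then have m3: "2 < m"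
    using AB D by (auto simp: small_def)
  have "m < card D + card S"
    using assms(3)[unfolded settled_def, rule_format, OF D(1) S(1)] S(3) by blast
  then have cS: "card S = m - 1"
    using S(2) D(2) unfolding small_def by linarith
  \<comment> \<open>A further block that is not full would be a singleton, and it would fit beside
    \<open>D\<close> because \<open>3 \<le> m\<close>.\<close>
  have "X = D \<or> X = S" if "X \<in> ?N" for X
  proof (rule ccontr)
    assume X: "\<not> (X = D \<or> X = S)"
    then have "\<not> small m X"
      using D(3) S that by (auto simp: good_def)
    then have "card X = 1"
      using card_one_iff that by blast
    moreover have "m < card D + card X"
      using assms(3)[unfolded settled_def, rule_format, OF D(1), of X] X that by blast
    ultimately show False
      using D m3 by simp
  qed
  then have N: "?N = {D, S}"
    using D S m3 by (auto simp: small_def)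
  have V: "card V = Suc q * m + 1"
    using q(2) S(3) D(2) cS m3 unfolding N by simp
  then show "card V mod m = 1"
    using m3 by (simp add: mod_Suc)
  have "m choose 2 = (m - 1 choose 2) + (m - 1)"
    using m3 by (cases m) (simp_all add: numeral_2_eq_2)
  moreover have "clique_edges P = q * (m choose 2) + (1 + (m - 1 choose 2))"
    using q(1) S(3) D(2) cS unfolding N clique_edges_def by simp
  moreover have "edges_bound m (card V) = Suc q * (m choose 2) + (1 choose 2)"
    unfolding V using m3 by (intro edges_bound_decomp) simp
  moreover have "(1::nat) choose 2 = 0"
    by (simp add: binomial_eq_0)
  ultimately show "clique_edges P + (m - 2) = edges_bound m (card V)"
    using m3 unfolding mult_Suc by linarith
qed

end

section \<open>Trees in a graph and the order of its components\<close>

section \<open>Trees as subgraphs\<close>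

lemma is_tree_singleton: "is_tree \<lparr>verts = {v}, edges = {}\<rparr>"
proof -
  have "\<not> is_cycle \<lparr>verts = {v}, edges = {}\<rparr> xs" for xs
    by (cases xs) (auto simp: is_cycle_def)
  then show ?thesis
    by (simp add: is_tree_def simple_graph_def connected_graph_def)
qed

text \<open>A vertex on a cycle has two distinct neighbours there, but \<open>x\<close> has only the
  neighbour \<open>y\<close>.\<close>

lemma is_cycle_delete_leaf:
  assumes "is_cycle \<lparr>verts = insert x V, edges = insert {y, x} E\<rparr> xs"
    and "x \<notin> V" and E: "\<And>e. e \<in> E \<Longrightarrow> e \<subseteq> V"
  shows "is_cycle \<lparr>verts = V, edges = E\<rparr> xs"
proof -
  let ?n = "length xs"
  have n: "3 \<le> ?n" "distinct xs" "set xs \<subseteq> insert x V"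
    using assms(1) by (auto simp: is_cycle_def)
  have edge: "{xs ! i, xs ! ((i + 1) mod ?n)} \<in> insert {y, x} E" if "i < ?n" for i
    using assms(1) that by (simp add: is_cycle_def)
  \<comment> \<open>The successor index is written without \<open>mod\<close>, so that the
    wrap-around becomes a plain case distinction.\<close>
  have step: "{xs ! i, xs ! (if Suc i = ?n then 0 else Suc i)} \<in> insert {y, x} E" if "i < ?n" for i
    using edge[OF that] that by (cases "Suc i = ?n") simp_all
  have only: "z = y" if "{x, z} \<in> insert {y, x} E" "z \<noteq> x" for z
    using that E[of "{x, z}"] \<open>x \<notin> V\<close> by (auto simp: doubleton_eq_iff)
  have "x \<notin> set xs"
  proof
    assume "x \<in> set xs"
    then obtain i where i: "i < ?n" "xs ! i = x"
      by (auto simp: in_set_conv_nth)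
    \<comment> \<open>\<open>a\<close> and \<open>b\<close> are the positions after and before
      \<open>i\<close> on the cycle; they differ because the length is at least 3.\<close>
    define a where "a = (if Suc i = ?n then 0 else Suc i)"
    define b where "b = (if i = 0 then ?n - 1 else i - 1)"
    have ab: "a < ?n" "b < ?n" "a \<noteq> i" "b \<noteq> i" "a \<noteq> b" "i = (if Suc b = ?n then 0 else Suc b)"
      using i n(1) by (auto simp: a_def b_def)
    then have "xs ! a \<noteq> x" "xs ! b \<noteq> x"
      using i n(2) nth_eq_iff_index_eq by metis+
    moreover have "{x, xs ! a} \<in> insert {y, x} E"
      using step[OF i(1)] i(2) by (simp add: a_def)
    moreover have "{x, xs ! b} \<in> insert {y, x} E"
      using step[OF ab(2)] unfolding ab(6)[symmetric] i(2) by (simp add: insert_commute)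
    ultimately have "xs ! a = xs ! b"
      using only by metis
    then show False
      using ab n(2) nth_eq_iff_index_eq by metis
  qed
  then have "set xs \<subseteq> V" using n by blast
  moreover have "{xs ! i, xs ! ((i + 1) mod ?n)} \<in> E" if "i < ?n" for i
  proof -
    have "(i + 1) mod ?n < ?n" using n(1) by (intro mod_less_divisor) linarith
    then have "xs ! i \<noteq> x" "xs ! ((i + 1) mod ?n) \<noteq> x"
      using \<open>x \<notin> set xs\<close> that by (metis nth_mem)+
    then show ?thesis
      using edge[OF that] by (auto simp: doubleton_eq_iff)
  qed
  ultimately show ?thesis
    using n by (simp add: is_cycle_def)
qed

lemma is_tree_insert_leaf:
  assumes T: "is_tree T" and y: "y \<in> verts T" and x: "x \<notin> verts T"
  shows "is_tree \<lparr>verts = insert x (verts T), edges = insert {y, x} (edges T)\<rparr>"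
proof -
  let ?R = "{(a, b). {a, b} \<in> edges T}" and ?R' = "{(a, b). {a, b} \<in> insert {y, x} (edges T)}"
  have edges: "\<And>e. e \<in> edges T \<Longrightarrow> e \<subseteq> verts T \<and> card e = 2" and fin: "finite (verts T)"
    and conn: "\<And>a b. a \<in> verts T \<Longrightarrow> b \<in> verts T \<Longrightarrow> (a, b) \<in> ?R\<^sup>*"
    and acyc: "\<And>xs. \<not> is_cycle T xs"
    using T by (auto simp: is_tree_def simple_graph_def connected_graph_def)
  have "?R \<subseteq> ?R'" by auto
  then have old: "(a, b) \<in> ?R'\<^sup>*" if "a \<in> verts T" "b \<in> verts T" for a b
    using conn[OF that] rtrancl_mono by blast
  have "(y, x) \<in> ?R'\<^sup>*" "(x, y) \<in> ?R'\<^sup>*"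
    by (auto simp: insert_commute intro!: r_into_rtrancl)
  \<comment> \<open>Any two vertices will be joined by way of \<open>y\<close>.\<close>
  then have to_y: "(a, y) \<in> ?R'\<^sup>*" "(y, a) \<in> ?R'\<^sup>*" if "a \<in> insert x (verts T)" for a
    using that old y by auto
  have "(a, b) \<in> ?R'\<^sup>*" if "a \<in> insert x (verts T)" "b \<in> insert x (verts T)" for a b
    using to_y(1)[OF that(1)] to_y(2)[OF that(2)] by (rule rtrancl_trans)
  moreover have "\<not> is_cycle \<lparr>verts = insert x (verts T), edges = insert {y, x} (edges T)\<rparr> xs" for xs
    using is_cycle_delete_leaf[OF _ x, of y "edges T" xs] edges acyc[of xs]
    by (auto simp: is_cycle_def)
  moreover have "e \<subseteq> insert x (verts T) \<and> card e = 2" if "e \<in> insert {y, x} (edges T)" for e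
    using that edges[of e] x y by (auto simp: card_insert_if)
  ultimately show ?thesis
    using fin unfolding is_tree_def simple_graph_def connected_graph_def by simp
qed

text \<open>The tree grows leaf by leaf: if no edge left it, it would be closed under adjacency and
  contain the whole component.\<close>

lemma exists_tree_in_component:
  assumes "1 \<le> j" "j \<le> card (component E v)"
  shows "\<exists>T. is_tree T \<and> card (verts T) = j \<and> verts T \<subseteq> component E v \<and> edges T \<subseteq> E"
  using assms
proof (induction j rule: nat_induct_at_least)
  case base
  show ?case
    by (rule exI[of _ "\<lparr>verts = {v}, edges = {}\<rparr>"]) (simp add: is_tree_singleton)
next
  case (Suc j)
  then obtain T where T: "is_tree T" "card (verts T) = j" "verts T \<subseteq> component E v" "edges T \<subseteq> E"
    by auto
  have fin: "finite (verts T)" using T by (simp add: is_tree_def)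
  obtain t where t: "t \<in> verts T" using T by (auto simp: is_tree_def connected_graph_def)
  have "\<exists>y\<in>verts T. \<exists>x. x \<notin> verts T \<and> {y, x} \<in> E"
  proof (rule ccontr)
    assume closed: "\<not> ?thesis"
    have "w \<in> verts T" if "(t, w) \<in> (adj E)\<^sup>*" for w
      using that by induction (use t closed in \<open>auto simp: adj_def\<close>)
    then have "component E t \<subseteq> verts T" by (auto simp: component_def)
    moreover have "component E t = component E v"
      using t T(3) component_eq[of t E v] by blast
    ultimately have "card (component E v) \<le> j"
      using T fin card_mono by metis
    then show False using Suc.prems by simp
  qed
  then obtain x y where xy: "y \<in> verts T" "x \<notin> verts T" "{y, x} \<in> E" by blast
  have "x \<in> component E v"
    using component_trans[OF _ component_edge[OF xy(3)]] xy(1) T(3) by blast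
  show ?case
    by (rule exI[of _ "\<lparr>verts = insert x (verts T), edges = insert {y, x} (edges T)\<rparr>"])
      (use is_tree_insert_leaf[OF T(1) xy(1,2)] T xy fin \<open>x \<in> component E v\<close> in simp)
qed

text \<open>Paths are mapped to paths, so the copy stays in a single component, and injectivity
  preserves its order.\<close>

lemma connected_copy_component:
  assumes "contains_copy G T" "connected_graph T" "finite (verts G)"
    and "\<And>e. e \<in> edges G \<Longrightarrow> e \<subseteq> verts G"
  shows "\<exists>v\<in>verts G. card (verts T) \<le> card (component (edges G) v)"
proof -
  obtain f where f: "inj_on f (verts T)" "f ` verts T \<subseteq> verts G"
    "\<And>e. e \<in> edges T \<Longrightarrow> f ` e \<in> edges G"
    using assms(1) by (auto simp: contains_copy_def)
  obtain t where t: "t \<in> verts T"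
    and conn: "\<And>w. w \<in> verts T \<Longrightarrow> (t, w) \<in> {(x, y). {x, y} \<in> edges T}\<^sup>*"
    using assms(2) by (auto simp: connected_graph_def)
  have "(f t, f w) \<in> (adj (edges G))\<^sup>*" if "(t, w) \<in> {(x, y). {x, y} \<in> edges T}\<^sup>*" for w
    using that
  proof induction
    case (step a b)
    then have "(f a, f b) \<in> adj (edges G)"
      using f(3)[of "{a, b}"] by (simp add: adj_def)
    with step.IH show ?case by (rule rtrancl_into_rtrancl)
  qed simp
  then have "f ` verts T \<subseteq> component (edges G) (f t)"
    using conn by (auto simp: component_def)
  moreover have "finite (component (edges G) (f t))"
    using component_subset[of "f t" "verts G" "edges G"] f(2) t assms(3,4) finite_subset by blast
  ultimately have "card (verts T) \<le> card (component (edges G) (f t))"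
    using card_image[OF f(1)] card_mono by metis
  then show ?thesis using f(2) t by blast
qed

lemma family_free_trees_iff:
  fixes G :: "nat ugraph"
  assumes "simple_graph G" "finite (verts G)"
  shows "family_free (trees (Suc m)) G \<longleftrightarrow> (\<forall>X\<in>components (verts G) (edges G). card X \<le> m)"
proof
  have edges: "\<And>e. e \<in> edges G \<Longrightarrow> e \<subseteq> verts G"
    using assms(1) by (auto simp: simple_graph_def)
  show "\<forall>X\<in>components (verts G) (edges G). card X \<le> m" if free: "family_free (trees (Suc m)) G"
  proof (rule ccontr)
    assume "\<not> ?thesis"
    then obtain v where v: "v \<in> verts G" "Suc m \<le> card (component (edges G) v)"
      by (auto simp: components_def not_le)
    obtain T where T: "is_tree T" "card (verts T) = Suc m"
      "verts T \<subseteq> component (edges G) v" "edges T \<subseteq> edges G"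
      using exists_tree_in_component[of "Suc m" "edges G" v] v by auto
    have "verts T \<subseteq> verts G"
      using T(3) component_subset[OF v(1) edges] by blast
    \<comment> \<open>The vertices of \<open>G\<close> are natural numbers, so \<open>T\<close>
      itself belongs to the family and the identity embeds it.\<close>
    then have "contains_copy G T"
      using T(4) by (auto simp: contains_copy_def intro!: exI[of _ id])
    then show False
      using free T by (auto simp: family_free_def trees_def)
  qed
  show "family_free (trees (Suc m)) G" if "\<forall>X\<in>components (verts G) (edges G). card X \<le> m"
  proof -
    have "\<not> contains_copy G T" if "T \<in> trees (Suc m)" for T
    proof
      assume "contains_copy G T"
      moreover have "connected_graph T" "card (verts T) = Suc m"
        using that by (auto simp: trees_def is_tree_def)
      ultimately obtain v where "v \<in> verts G" "Suc m \<le> card (component (edges G) v)"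
        using connected_copy_component[of G T] assms(2) edges by auto
      then show False
        using \<open>\<forall>X\<in>components (verts G) (edges G). card X \<le> m\<close> by (auto simp: components_def)
    qed
    then show ?thesis by (simp add: family_free_def)
  qed
qed

section \<open>Positions and legal moves in terms of component sizes\<close>

section \<open>The game\<close>

text \<open>Component sizes replace tree-freeness, with \<open>m = k - 1\<close>;
  \<open>family_free_position_iff\<close> is the link to the game.\<close>

definition position :: "nat \<Rightarrow> nat \<Rightarrow> nat set set \<Rightarrow> bool" where
  "position n m E \<longleftrightarrow> E \<subseteq> edges (complete_graph n) \<and> (\<forall>X\<in>components {..<n} E. card X \<le> m)"

abbreviation moves :: "nat \<Rightarrow> nat \<Rightarrow> nat set set \<Rightarrow> nat set set" where
  "moves n m \<equiv> legal_moves (complete_graph n) (trees (Suc m))"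

lemma verts_complete_graph: "verts (complete_graph n) = {..<n}"
  and edges_complete_graph: "edges (complete_graph n) = {e. e \<subseteq> {..<n} \<and> card e = 2}"
  by (simp_all add: complete_graph_def)

lemma simple_complete_graph: "simple_graph (complete_graph n)"
  by (simp add: simple_graph_def verts_complete_graph edges_complete_graph)

lemma finite_complete_edges: "finite (edges (complete_graph n))"
  by (rule finite_subset[of _ "Pow {..<n}"]) (auto simp: edges_complete_graph)

lemma complete_edge_pair:
  assumes "e \<in> edges (complete_graph n)"
  obtains u v where "e = {u, v}" "u < n" "v < n" "u \<noteq> v"
  using assms by (auto simp: card_2_iff edges_complete_graph)

lemma family_free_position_iff:
  assumes "E \<subseteq> edges (complete_graph n)"
  shows "family_free (trees (Suc m)) (position_graph (complete_graph n) E) \<longleftrightarrow> position n m E"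
  using assms
  by (subst family_free_trees_iff)
    (auto simp: position_def simple_graph_def verts_complete_graph edges_complete_graph)

lemma moves_iff:
  assumes "position n m E"
  shows "e \<in> moves n m E \<longleftrightarrow> e \<in> edges (complete_graph n) \<and> e \<notin> E \<and> position n m (insert e E)"
proof (cases "e \<in> edges (complete_graph n)")
  case True
  then have "insert e E \<subseteq> edges (complete_graph n)"
    using assms by (auto simp: position_def)
  then show ?thesis
    using True by (simp add: legal_moves_def family_free_position_iff)
next
  case False
  then show ?thesis by (simp add: legal_moves_def)
qed

lemma saturated_iff_no_moves:
  assumes "position n m E"
  shows "saturated_in (complete_graph n) (trees (Suc m)) (position_graph (complete_graph n) E)
    \<longleftrightarrow> moves n m E = {}"
proof (rule saturated_in_iff_no_legal_moves[OF simple_complete_graph])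
  show E: "E \<subseteq> edges (complete_graph n)"
    using assms by (simp add: position_def)
  show "family_free (trees (Suc m)) (position_graph (complete_graph n) E)"
    using assms family_free_position_iff[OF E] by simp
qed

section \<open>Moves as merges of components\<close>

lemma components_position:
  assumes "position n m E" "2 \<le> m"
  shows "bounded_partition m {..<n} (components {..<n} E)"
proof
  show "partition_on {..<n} (components {..<n} E)"
    using assms(1) by (intro partition_on_components) (auto simp: position_def edges_complete_graph)
qed (use assms in \<open>auto simp: position_def\<close>)

text \<open>Such an edge leaves the partition unchanged and so breaks no size bound; hence
  components are cliques at the end.\<close>

lemma move_inside_component:
  assumes "position n m E" "u < n" "v < n" "u \<noteq> v" "v \<in> component E u" "{u, v} \<notin> E"
  shows "{u, v} \<in> moves n m E"
proof -
  have "components {..<n} (insert {u, v} E) = components {..<n} E"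
    by (simp add: components_def component_insert_same[OF assms(5)])
  then show ?thesis
    using assms(1-4,6) unfolding moves_iff[OF assms(1)]
    by (simp add: position_def edges_complete_graph)
qed

text \<open>An edge between representatives realises the merge that a strategy asks for; it cannot
  be present already, since its ends would then share a component.\<close>

lemma move_merging_components:
  assumes "position n m E" "2 \<le> m"
    and XY: "X \<in> components {..<n} E" "Y \<in> components {..<n} E" "X \<noteq> Y" "card X + card Y \<le> m"
  obtains e where "e \<in> moves n m E"
    "components {..<n} (insert e E) = merge X Y (components {..<n} E)"
proof -
  interpret bounded_partition m "{..<n}" "components {..<n} E"
    using components_position assms by blast
  obtain u v where u: "u < n" "X = component E u" and v: "v < n" "Y = component E v"
    using XY by (auto simp: components_def)
  have new: "components {..<n} (insert {u, v} E) = merge X Y (components {..<n} E)"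
    using components_insert_merge[of u "{..<n}" v E] u v by (simp add: merge_def)
  have "card (X \<union> Y) \<le> m"
    using XY card_Un_blocks by simp
  moreover have "u \<noteq> v" using u v XY(3) by blast
  then have edge: "{u, v} \<in> edges (complete_graph n)"
    using u v by (simp add: edges_complete_graph)
  ultimately have "position n m (insert {u, v} E)"
    using assms(1) new by (auto simp: position_def merge_def)
  moreover have "{u, v} \<notin> E"
    using component_edge[of u v E] component_eq[of v E u] u v XY(3) by auto
  ultimately have "{u, v} \<in> moves n m E"
    using edge moves_iff[OF assms(1)] by blast
  then show ?thesis using that new by blast
qed

text \<open>A legal edge has both ends in one component or joins two; in the latter case legality of
  the new position bounds their union.\<close>

lemma components_move:
  assumes "position n m E" "2 \<le> m" "e \<in> moves n m E"
  shows "components {..<n} (insert e E) = components {..<n} E \<or>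
    (\<exists>X\<in>components {..<n} E. \<exists>Y\<in>components {..<n} E. X \<noteq> Y \<and> card X + card Y \<le> m \<and>
       components {..<n} (insert e E) = merge X Y (components {..<n} E))"
proof -
  interpret bounded_partition m "{..<n}" "components {..<n} E"
    using components_position assms by blast
  have e: "e \<in> edges (complete_graph n)" "position n m (insert e E)"
    using assms(3) unfolding moves_iff[OF assms(1)] by blast+
  obtain u v where uv: "e = {u, v}" "u < n" "v < n" "u \<noteq> v"
    using complete_edge_pair[OF e(1)] .
  show ?thesis
  proof (cases "component E u = component E v")
    case True
    then have "v \<in> component E u" by simp
    then show ?thesis
      using component_insert_same[of v E u] by (simp add: components_def uv(1))
  next
    case False
    have blocks: "component E u \<in> components {..<n} E" "component E v \<in> components {..<n} E"
      using uv by (auto simp: components_def)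
    have new: "components {..<n} (insert e E) =
        merge (component E u) (component E v) (components {..<n} E)"
      using components_insert_merge[of u "{..<n}" v E] uv by (simp add: merge_def)
    then have "card (component E u \<union> component E v) \<le> m"
      using e(2) by (simp add: position_def merge_def)
    then have "card (component E u) + card (component E v) \<le> m"
      using card_Un_blocks[OF blocks False] by simp
    then show ?thesis
      using blocks False new by blast
  qed
qed

lemma components_move_settled:
  assumes "position n m E" "2 \<le> m" "e \<in> moves n m E" "settled m (components {..<n} E)"
  shows "components {..<n} (insert e E) = components {..<n} E"
proof -
  have "\<not> card X + card Y \<le> m"
    if "X \<in> components {..<n} E" "Y \<in> components {..<n} E" "X \<noteq> Y" for X Y
    using assms(4)[unfolded settled_def, rule_format, OF that] by simp
  then show ?thesis
    using components_move[OF assms(1-3)] by blast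
qed

lemma settled_if_no_moves:
  assumes "position n m E" "2 \<le> m" "moves n m E = {}"
  shows "settled m (components {..<n} E)"
  unfolding settled_def
proof (intro ballI impI, rule ccontr)
  fix X Y assume *: "X \<in> components {..<n} E" "Y \<in> components {..<n} E" "X \<noteq> Y"
    "\<not> m < card X + card Y"
  then obtain e where "e \<in> moves n m E"
    using move_merging_components[OF assms(1,2), of X Y] by (auto simp: not_less)
  then show False using assms(3) by simp
qed

section \<open>Counting the edges of positions\<close>

lemma card_cliques:
  assumes "finite V" "partition_on V P"
  shows "card (\<Union>X\<in>P. {e. e \<subseteq> X \<and> card e = 2}) = clique_edges P"
proof -
  have fin: "finite P"
    using finite_elements[OF assms] .
  have finX: "finite X" if "X \<in> P" for X
    using finite_subset[OF _ assms(1), of X] partition_onD1[OF assms(2)] that by blast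
  have "card (\<Union>X\<in>P. {e. e \<subseteq> X \<and> card e = 2}) = (\<Sum>X\<in>P. card {e. e \<subseteq> X \<and> card e = 2})"
  proof (rule card_UN_disjoint[OF fin])
    show "\<forall>X\<in>P. finite {e. e \<subseteq> X \<and> card e = 2}"
      using finX by simp
    show "\<forall>X\<in>P. \<forall>Y\<in>P. X \<noteq> Y \<longrightarrow> {e. e \<subseteq> X \<and> card e = 2} \<inter> {e. e \<subseteq> Y \<and> card e = 2} = {}"
    proof (intro ballI impI equals0I)
      fix X Y e
      assume XY: "X \<in> P" "Y \<in> P" "X \<noteq> Y"
        and e: "e \<in> {e. e \<subseteq> X \<and> card e = 2} \<inter> {e. e \<subseteq> Y \<and> card e = 2}"
      have "X \<inter> Y = {}"
        using disjointD[OF partition_onD2[OF assms(2)] XY] .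
      then have "e = {}" using e by blast
      then show False using e by simp
    qed
  qed
  also have "\<dots> = clique_edges P"
    unfolding clique_edges_def using finX by (intro sum.cong) (simp_all add: n_subsets)
  finally show ?thesis .
qed

lemma edges_subset_cliques:
  assumes "position n m E"
  shows "E \<subseteq> (\<Union>X\<in>components {..<n} E. {e. e \<subseteq> X \<and> card e = 2})"
proof
  fix e assume "e \<in> E"
  moreover from this have "e \<in> edges (complete_graph n)"
    using assms by (auto simp: position_def)
  moreover from this obtain u v where "e = {u, v}" "u < n" "v < n" "u \<noteq> v"
    by (rule complete_edge_pair)
  ultimately show "e \<in> (\<Union>X\<in>components {..<n} E. {e. e \<subseteq> X \<and> card e = 2})"
    using component_edge[of u v E] by (auto simp: components_def)
qed

lemma card_position_le:
  assumes "position n m E" "2 \<le> m"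
  shows "card E \<le> edges_bound m n"
proof -
  interpret bounded_partition m "{..<n}" "components {..<n} E"
    using components_position assms by blast
  have "finite (\<Union>X\<in>components {..<n} E. {e. e \<subseteq> X \<and> card e = 2})"
    using finite_P finite_block by simp
  then have "card E \<le> clique_edges (components {..<n} E)"
    using card_mono[OF _ edges_subset_cliques[OF assms(1)]] card_cliques[OF finite_V partition]
    by simp
  also have "\<dots> \<le> edges_bound m n"
    using clique_edges_le by simp
  finally show ?thesis .
qed

text \<open>A missing pair inside a component would still be a move.\<close>

lemma card_if_no_moves:
  assumes "position n m E" "2 \<le> m" "moves n m E = {}"
  shows "card E = clique_edges (components {..<n} E)"
proof -
  interpret bounded_partition m "{..<n}" "components {..<n} E"
    using components_position assms by blast
  have "(\<Union>X\<in>components {..<n} E. {e. e \<subseteq> X \<and> card e = 2}) \<subseteq> E"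
  proof
    fix e assume "e \<in> (\<Union>X\<in>components {..<n} E. {e. e \<subseteq> X \<and> card e = 2})"
    then obtain X where X: "X \<in> components {..<n} E" "e \<subseteq> X" "card e = 2" by blast
    then have "e \<in> edges (complete_graph n)"
      using partition_onD1[OF partition] by (auto simp: edges_complete_graph)
    then obtain u v where uv: "e = {u, v}" "u < n" "v < n" "u \<noteq> v"
      by (rule complete_edge_pair)
    obtain w where "X = component E w"
      using X by (auto simp: components_def)
    then have "v \<in> component E u"
      using X(2) uv(1) component_eq[of u E w] by simp
    then show "e \<in> E"
      using move_inside_component[OF assms(1) uv(2-4)] assms(3) uv(1) by auto
  qed
  then have "E = (\<Union>X\<in>components {..<n} E. {e. e \<subseteq> X \<and> card e = 2})"
    using edges_subset_cliques[OF assms(1)] by (rule equalityI[rotated])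
  then show ?thesis
    using card_cliques[OF finite_V partition] by simp
qed

section \<open>Values of positions, by induction on the number of unplayed edges\<close>

lemma position_value_final:
  assumes "position n m E" "moves n m E = {}"
  shows "position_value (complete_graph n) (trees (Suc m)) p E = card E"
  using assms by (subst position_value.simps) (simp add: saturated_iff_no_moves)

lemma position_value_step:
  assumes "position n m E" "moves n m E \<noteq> {}"
  shows "position_value (complete_graph n) (trees (Suc m)) p E =
    (case p of Prolonger \<Rightarrow> Max | Shortener \<Rightarrow> Min)
      ((\<lambda>e. position_value (complete_graph n) (trees (Suc m)) (opponent p) (insert e E)) ` moves n m E)"
  using assms finite_complete_edges
  by (subst position_value.simps) (simp add: saturated_iff_no_moves)

lemma finite_moves: "finite (moves n m E)"
  using finite_complete_edges by (rule finite_subset[rotated]) (auto simp: legal_moves_def)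

lemma card_remaining_less:
  assumes "e \<in> moves n m E"
  shows "card (edges (complete_graph n) - insert e E) < card (edges (complete_graph n) - E)"
  using assms finite_complete_edges[of n]
  by (intro psubset_card_mono) (auto simp: legal_moves_def)

text \<open>No strategy of Shortener is involved: the bound holds at every end of the game and is
  passed back unchanged.\<close>

lemma position_value_le:
  assumes "position n m E" "2 \<le> m"
  shows "position_value (complete_graph n) (trees (Suc m)) p E \<le> edges_bound m n"
  using assms(1)
proof (induction "card (edges (complete_graph n) - E)" arbitrary: p E rule: less_induct)
  case less
  show ?case
  proof (cases "moves n m E = {}")
    case True
    then show ?thesis
      using less.prems card_position_le assms(2) by (simp add: position_value_final)
  next
    case False
    let ?S = "(\<lambda>e. position_value (complete_graph n) (trees (Suc m)) (opponent p) (insert e E)) ` moves n m E"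
    have le: "x \<le> edges_bound m n" if "x \<in> ?S" for x
      using that less.hyps[OF card_remaining_less] moves_iff[OF less.prems] by blast
    have S: "finite ?S" "?S \<noteq> {}"
      using finite_moves False by auto
    \<comment> \<open>Both \<open>Max\<close> and \<open>Min\<close> pick the value of an actual
      successor, to which the induction hypothesis applies.\<close>
    then have "Max ?S \<in> ?S" "Min ?S \<in> ?S"
      by (rule Max_in, rule Min_in)
    then show ?thesis
      using le unfolding position_value_step[OF less.prems False] by (cases p) (simp_all only: player.case)
  qed
qed

text \<open>A strategy is packed into an invariant \<open>I\<close>: one successor bounds
  \<open>Max\<close> from below, so a single chosen move suffices for Prolonger, while
  \<open>Min\<close> requires all moves of Shortener.\<close>

lemma position_value_ge:
  assumes inv: "\<And>p E. I p E \<Longrightarrow> position n m E"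
    and final: "\<And>p E. I p E \<Longrightarrow> moves n m E = {} \<Longrightarrow> t \<le> card E"
    and shortener: "\<And>E e. I Shortener E \<Longrightarrow> e \<in> moves n m E \<Longrightarrow> I Prolonger (insert e E)"
    and prolonger: "\<And>E. I Prolonger E \<Longrightarrow> moves n m E \<noteq> {} \<Longrightarrow>
      \<exists>e\<in>moves n m E. I Shortener (insert e E)"
    and "I p E"
  shows "t \<le> position_value (complete_graph n) (trees (Suc m)) p E"
  using \<open>I p E\<close>
proof (induction "card (edges (complete_graph n) - E)" arbitrary: p E rule: less_induct)
  case less
  note pos = inv[OF less.prems]
  show ?case
  proof (cases "moves n m E = {}")
    case True
    then show ?thesis
      using final[OF less.prems] pos by (simp add: position_value_final)
  next
    case False
    let ?f = "\<lambda>e. position_value (complete_graph n) (trees (Suc m)) (opponent p) (insert e E)"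
    let ?S = "?f ` moves n m E"
    have S: "finite ?S" "?S \<noteq> {}"
      using finite_moves False by auto
    show ?thesis
    proof (cases p)
      case Prolonger
      then obtain e where e: "e \<in> moves n m E" "I Shortener (insert e E)"
        using prolonger less.prems False by blast
      then have "t \<le> ?f e"
        using less.hyps[OF card_remaining_less[OF e(1)] e(2)] Prolonger by simp
      also have "?f e \<le> Max ?S"
        using S(1) e(1) by (intro Max_ge) auto
      finally show ?thesis
        unfolding position_value_step[OF pos False] using Prolonger by simp
    next
      case Shortener
      have "t \<le> x" if "x \<in> ?S" for x
      proof -
        from that obtain e where e: "e \<in> moves n m E" "x = ?f e"
          by blast
        then show ?thesis
          using less.hyps[OF card_remaining_less[OF e(1)], of Prolonger] shortener less.prems Shortener
          by simp
      qed
      then have "t \<le> Min ?S"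
        using S by simp
      then show ?thesis
        unfolding position_value_step[OF pos False] using Shortener by simp
    qed
  qed
qed

section \<open>Prolonger's strategy as an invariant\<close>

text \<open>The loss \<open>m - 2\<close>, that is \<open>k - 3\<close>, allows for an end with
  components of orders \<open>m - 1\<close> and 2. For \<open>n = 1\<close> the truncated
  subtraction gives 0.\<close>

definition prolonger_target :: "nat \<Rightarrow> nat \<Rightarrow> nat" where
  "prolonger_target m n = (if n mod m = 1 then edges_bound m n - (m - 2) else edges_bound m n)"

text \<open>A settled partition need not be good when Shortener is to move, but no move changes it
  any more; hence the first alternative.\<close>

definition prolonger_invariant :: "nat \<Rightarrow> nat \<Rightarrow> player \<Rightarrow> nat set set \<Rightarrow> bool" where
  "prolonger_invariant n m p E \<longleftrightarrow> position n m E \<and>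
     (let P = components {..<n} E in
       settled m P \<and> prolonger_target m n \<le> clique_edges P \<or>
       (case p of Prolonger \<Rightarrow> nearly_good m P | Shortener \<Rightarrow> good m P))"

text \<open>A good partition is nearly good, so one argument serves both players: a good one attains
  the full bound, and one that is merely nearly good occurs only for \<open>n mod m = 1\<close>,
  with exactly the allowed loss.\<close>

lemma prolonger_invariant_settled:
  assumes "prolonger_invariant n m p E" "2 \<le> m" "settled m (components {..<n} E)"
  shows "prolonger_target m n \<le> clique_edges (components {..<n} E)"
proof -
  let ?P = "components {..<n} E"
  interpret bounded_partition m "{..<n}" ?P
    using components_position assms by (auto simp: prolonger_invariant_def)
  consider "prolonger_target m n \<le> clique_edges ?P" | "nearly_good m ?P"
    using assms(1) by (cases p) (auto simp: prolonger_invariant_def nearly_good_def Let_def)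
  then show ?thesis
  proof cases
    case 2
    show ?thesis
    proof (cases "good m ?P")
      case True
      then show ?thesis
        using clique_edges_good_settled assms(3) by (simp add: prolonger_target_def)
    next
      case False
      then show ?thesis
        using clique_edges_nearly_good_settled[OF 2 False assms(3)] by (simp add: prolonger_target_def)
    qed
  qed
qed

text \<open>Once merging has ended the turn no longer matters, which is why the next player
  \<open>q\<close> is arbitrary.\<close>

lemma prolonger_invariant_move_settled:
  assumes "prolonger_invariant n m p E" "2 \<le> m" "settled m (components {..<n} E)" "e \<in> moves n m E"
  shows "prolonger_invariant n m q (insert e E)"
proof -
  have "position n m E" using assms(1) by (simp add: prolonger_invariant_def)
  then show ?thesis
    using components_move_settled[of n m E e] prolonger_invariant_settled[OF assms(1-3)] assms(2-4)
      moves_iff[of n m E e]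
    by (simp add: prolonger_invariant_def)
qed

lemma prolonger_invariant_shortener_move:
  assumes "prolonger_invariant n m Shortener E" "2 \<le> m" "e \<in> moves n m E"
  shows "prolonger_invariant n m Prolonger (insert e E)"
proof (cases "settled m (components {..<n} E)")
  case True
  then show ?thesis using prolonger_invariant_move_settled assms by blast
next
  case False
  let ?P = "components {..<n} E"
  have pos: "position n m E" and good: "good m ?P"
    using assms(1) False by (auto simp: prolonger_invariant_def Let_def)
  interpret bounded_partition m "{..<n}" ?P
    using components_position pos assms(2) by blast
  have "nearly_good m (components {..<n} (insert e E))"
    using components_move[OF pos assms(2,3)]
  proof
    assume "components {..<n} (insert e E) = ?P"
    \<comment> \<open>A move inside a component merely passes the turn: a good partition is in
      particular nearly good.\<close>
    then show ?thesis using good by (simp add: nearly_good_def)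
  next
    assume "\<exists>X\<in>?P. \<exists>Y\<in>?P. X \<noteq> Y \<and> card X + card Y \<le> m \<and>
      components {..<n} (insert e E) = merge X Y ?P"
    then obtain X Y where "X \<in> ?P" "Y \<in> ?P" "X \<noteq> Y" "card X + card Y \<le> m"
      and new: "components {..<n} (insert e E) = merge X Y ?P"
      by blast
    then show ?thesis
      unfolding new by (intro nearly_good_merge[OF good])
  qed
  then show ?thesis
    using assms(3) moves_iff[OF pos] by (simp add: prolonger_invariant_def Let_def)
qed

lemma prolonger_invariant_prolonger_move:
  assumes "prolonger_invariant n m Prolonger E" "2 \<le> m" "moves n m E \<noteq> {}"
  shows "\<exists>e\<in>moves n m E. prolonger_invariant n m Shortener (insert e E)"
proof (cases "settled m (components {..<n} E)")
  case True
  then show ?thesis using prolonger_invariant_move_settled assms by blast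
next
  case False
  let ?P = "components {..<n} E"
  have pos: "position n m E" and "nearly_good m ?P"
    using assms(1) False by (auto simp: prolonger_invariant_def Let_def)
  interpret bounded_partition m "{..<n}" ?P
    using components_position pos assms(2) by blast
  obtain X Y where XY: "X \<in> ?P" "Y \<in> ?P" "X \<noteq> Y" "card X + card Y \<le> m" "good m (merge X Y ?P)"
    using nearly_good_move[OF \<open>nearly_good m ?P\<close> False] .
  obtain e where e: "e \<in> moves n m E" "components {..<n} (insert e E) = merge X Y ?P"
    using move_merging_components[OF pos assms(2) XY(1-4)] .
  then have "prolonger_invariant n m Shortener (insert e E)"
    using XY(5) moves_iff[OF pos] by (simp add: prolonger_invariant_def Let_def)
  then show ?thesis using e(1) by blast
qed

lemma components_empty: "X \<in> components V {} \<Longrightarrow> card X = 1"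
  by (auto simp: components_def component_def adj_def)

section \<open>Bounds for the game with either first player\<close>

lemma game_saturation_number_bounds:
  assumes "2 \<le> m"
  shows "prolonger_target m n \<le> game_saturation_number first (complete_graph n) (trees (Suc m))"
    and "game_saturation_number first (complete_graph n) (trees (Suc m)) \<le> edges_bound m n"
proof -
  have pos: "position n m {}"
    using components_empty assms by (force simp: position_def)
  \<comment> \<open>All blocks are singletons at the start, so none is small; as \<open>good\<close>
    implies \<open>nearly_good\<close>, either player may begin.\<close>
  have "good m (components {..<n} {})"
    using components_empty by (fastforce simp: good_def small_def)
  then have start: "prolonger_invariant n m first {}"
    using pos by (cases first) (simp_all add: prolonger_invariant_def nearly_good_def Let_def)
  show "prolonger_target m n \<le> game_saturation_number first (complete_graph n) (trees (Suc m))"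
    unfolding game_saturation_number_def
  proof (rule position_value_ge[where I = "prolonger_invariant n m"])
    fix p E assume inv: "prolonger_invariant n m p E"
    then show pos: "position n m E" by (simp add: prolonger_invariant_def)
    assume "moves n m E = {}"
    then show "prolonger_target m n \<le> card E"
      using prolonger_invariant_settled[OF inv assms] settled_if_no_moves[OF pos assms]
        card_if_no_moves[OF pos assms] by simp
  next
    fix E e assume "prolonger_invariant n m Shortener E" "e \<in> moves n m E"
    then show "prolonger_invariant n m Prolonger (insert e E)"
      using prolonger_invariant_shortener_move assms by blast
  next
    fix E assume "prolonger_invariant n m Prolonger E" "moves n m E \<noteq> {}"
    then show "\<exists>e\<in>moves n m E. prolonger_invariant n m Shortener (insert e E)"
      using prolonger_invariant_prolonger_move assms by blast
  qed (rule start)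
  show "game_saturation_number first (complete_graph n) (trees (Suc m)) \<le> edges_bound m n"
    unfolding game_saturation_number_def using position_value_le[OF pos assms] .
qed

theorem theorem4:
  fixes n k :: nat and first :: player
  assumes "n \<ge> 1" and "k \<ge> 2"
  shows "(\<not> [n = 1] (mod (k - 1)) \<longrightarrow>
           game_saturation_number first (complete_graph n) (trees k) =
             (n div (k - 1)) * ((k - 1) choose 2) +
             ((n - (k - 1) * (n div (k - 1))) choose 2)) \<and>
         ([n = 1] (mod (k - 1)) \<and> k \<ge> 3 \<longrightarrow>
           int (n div (k - 1)) * int ((k - 1) choose 2) - (int k - 3)
             \<le> int (game_saturation_number first (complete_graph n) (trees k)) \<and>
           int (game_saturation_number first (complete_graph n) (trees k))
             \<le> int (n div (k - 1)) * int ((k - 1) choose 2))"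
proof (cases "k = 2")
  case True
  \<comment> \<open>Modulo 1 all numbers are congruent, and the second part requires
    \<open>k \<ge> 3\<close>, so both parts are vacuous for \<open>k = 2\<close>.\<close>
  then show ?thesis by (simp add: cong_def)
next
  case False
  define m where "m = k - 1"
  have m: "2 \<le> m" and k: "k = Suc m" using assms(2) False by (simp_all add: m_def)
  let ?g = "game_saturation_number first (complete_graph n) (trees (Suc m))"
  note bounds = game_saturation_number_bounds[OF m, where n = n and first = first]
  have cong: "[n = 1] (mod m) \<longleftrightarrow> n mod m = 1"
    using m by (simp add: cong_def)
  show ?thesis
  proof (intro conjI impI; (elim conjE)?)
    assume "\<not> [n = 1] (mod (k - 1))"
    then have "?g = edges_bound m n"
      using bounds cong by (simp add: k prolonger_target_def)
    then show "game_saturation_number first (complete_graph n) (trees k) =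
        (n div (k - 1)) * ((k - 1) choose 2) + ((n - (k - 1) * (n div (k - 1))) choose 2)"
      by (simp add: k edges_bound_def minus_mult_div_eq_mod)
  next
    assume "[n = 1] (mod (k - 1))"
    then have mod: "n mod m = 1" using cong by (simp add: k)
    \<comment> \<open>The remaining clique has one vertex and hence no edges.\<close>
    then have eq: "edges_bound m n = n div m * (m choose 2)"
      by (simp add: edges_bound_def binomial_eq_0)
    \<comment> \<open>Truncated subtraction never lies below the integer difference; with
      \<open>k = Suc m\<close> the loss \<open>int m - 2\<close> is
      \<open>int k - 3\<close>.\<close>
    have "int (edges_bound m n) - (int m - 2) \<le> int ?g"
      using bounds(1) mod m by (simp add: prolonger_target_def)
    then show "int (n div (k - 1)) * int ((k - 1) choose 2) - (int k - 3)
        \<le> int (game_saturation_number first (complete_graph n) (trees k))"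
      by (simp add: k eq)
    have "int ?g \<le> int (edges_bound m n)"
      using bounds(2) by simp
    then show "int (game_saturation_number first (complete_graph n) (trees k))
        \<le> int (n div (k - 1)) * int ((k - 1) choose 2)"
      by (simp add: k eq)
  qed
qed

end
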